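(* Let $\mathcal I=(t,m,n,\mathcal X,\mathcal X^{(S)},R)$ be an instance of the ICCSI problem over $\mathbb F_q$ with $t>1$ and message space $\mathcal M\subset\mathbb F_q^{n\times t}$, and let $\delta\ge0$ be an integer. Then, for the rank metric, $$N(t,\alpha(\mathcal I),2\delta+1)\le\mathcal N(\mathcal I,\delta).$$
   Context: Notation: $q$ is a prime power, $\mathbb F_q$ the field with $q$ elements, $[m]=\{1,\dots,m\}$. For a matrix $A$, $A_i$ is its $i$-th row and $\langle A\rangle$ its row space; $w(A)$ is the rank of $A$, and the rank distance between $A,B$ is the rank of $A-B$. Instance of the ICCSI (index coding with coded side information) problem: positive integers $t>1$, $m$, $n$; subspaces $\mathcal X^{(S)}$ and $\mathcal X^{(i)}$ ($i\in[m]$) of $\mathbb F_q^n$ of dimensions $d_S$ and $d_i$; $\mathcal X=\{A\in\mathbb F_q^{m\times n}:A_i\in\mathcal X^{(i)},\ i\in[m]\}$; a matrix $R\in\mathbb F_q^{m\times n}$ with rows $R_i\in\mathcal X^{(S)}\setminus\mathcal X^{(i)}$. Fix $V^{(S)}\in\mathbb F_q^{d_S\times n}$, $V^{(i)}\in\mathbb F_q^{d_i\times n}$ with $\langle V^{(S)}\rangle=\mathcal X^{(S)}$, $\langle V^{(i)}\rangle=\mathcal X^{(i)}$. Set $\mathcal Z_\delta^{(i)}=\{Z\in\mathbb F_q^{n\times t}:V^{(i)}Z=0,\ R_iZ\ne0,\ \operatorname{rank}(Z)\ge2\delta+1\}$. Message space: $\mathcal M\subset\mathbb F_q^{n\times t}$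 has minimum rank distance at least $2\delta+1$, and $\{V^{(S)}X:X\in\mathcal M\}\subset\mathbb F_q^{d_S\times t}$ has minimum rank distance $2\delta+1$. Error-correcting index codes: $L\in\mathbb F_q^{N\times d_S}$ ($N$ a positive integer) represents an $\mathbb F_q$-linear rank metric $(\mathcal I,\delta)$-ECIC of length $N$ if for each $i\in[m]$ there is a map $D_i:\mathbb F_q^{N\times t}\times\mathbb F_q^{d_i\times t}\to\mathbb F_q^t$ with $D_i(LV^{(S)}X+W,V^{(i)}X)=R_iX$ for all $X\in\mathcal M$ and all $W\in\mathbb F_q^{N\times t}$ with $w(W)\le\delta$. $\mathcal N(\mathcal I,\delta)$ is the optimal (minimum) length $N$ of such a code. $N(t,\log_qM,d)$ is the least integer $s$ such that there exists a code (subset) in $\mathbb F_q^{s\times t}$ of minimum rank distance $d$ and size $M$. Let $\mathcal J(\mathcal I)$ be the collection of subsets $U\subset\mathbb F_q^{n\times t}$ such that $X-X'\in\bigcup_{i\in[m]}\mathcal Z_\delta^{(i)}$ for any distinct $X,X'\in U$, and $\alpha(\mathcal I)=\max\{\log_q|U|:U\in\mathcal J(\mathcal I),\ U\neq\emptyset\}$. It is understood that $\alpha(\mathcal I)>0$, so that $N(t,\alpha(\mathcal I),2\delta+1)$ is defined (a one-element code has no minimum distance).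
   Formalization: The sets U in J(I), hence in α(I), are restricted to subsets of M; for arbitrary U the bound fails: m=n=t=2, δ=0, R=V^(S)=I, X^(i)=0, M={0,E_11} gives N(I,0)=1, but α=4 and N(2,4,1)=2. *)

theory Defs
  imports Complex_Main "Jordan_Normal_Form.DL_Rank" "HOL-Library.Cardinality" "HOL-Library.FuncSet"
begin

text \<open>The ground field is a type of class finite and field, so that \<open>q = CARD('a)\<close>.
  Indices \<open>1, ..., m\<close> of the mathematics are shifted to \<open>0, ..., m - 1\<close>.\<close>

definition mat_rank :: "'a::field mat \<Rightarrow> nat" where
  "mat_rank A = vec_space.rank (dim_row A) A"

definition has_min_rank_dist :: "'a::field mat set \<Rightarrow> nat \<Rightarrow> bool" where
  "has_min_rank_dist C d \<longleftrightarrow>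
     (\<exists>A\<in>C. \<exists>B\<in>C. A \<noteq> B \<and> mat_rank (A - B) = d) \<and>
     (\<forall>A\<in>C. \<forall>B\<in>C. A \<noteq> B \<longrightarrow> d \<le> mat_rank (A - B))"

text \<open>The second argument of \<open>N(t, log_q M, d)\<close> is the (real) logarithm of the code size. The
  type argument is needed because the field does not occur in the types of the other arguments.\<close>

definition opt_code_length :: "'a::{finite,field} itself \<Rightarrow> nat \<Rightarrow> real \<Rightarrow> nat \<Rightarrow> nat" where
  "opt_code_length _ t a d =
     (LEAST s. \<exists>C::'a mat set. C \<subseteq> carrier_mat s t \<and> has_min_rank_dist C d \<and>
                 log (real CARD('a)) (real (card C)) = a)"

definition is_subspace :: "nat \<Rightarrow> 'a::field vec set \<Rightarrow> bool" where
  "is_subspace n W \<longleftrightarrow> VectorSpace.subspace class_ring W (module_vec TYPE('a) n)"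

definition subspace_dim :: "nat \<Rightarrow> 'a::field vec set \<Rightarrow> nat" where
  "subspace_dim n W = vectorspace.dim class_ring ((module_vec TYPE('a) n)\<lparr>carrier := W\<rparr>)"

definition iccsi_instance ::
  "nat \<Rightarrow> nat \<Rightarrow> nat \<Rightarrow> 'a::{finite,field} mat set \<Rightarrow> 'a vec set \<Rightarrow> (nat \<Rightarrow> 'a vec set) \<Rightarrow>
   'a mat \<Rightarrow> bool" where
  "iccsi_instance t m n XX XS Xr R \<longleftrightarrow>
     t > 1 \<and> m > 0 \<and> n > 0 \<and>
     is_subspace n XS \<and> (\<forall>i<m. is_subspace n (Xr i)) \<and>
     XX = {A \<in> carrier_mat m n. \<forall>i<m. row A i \<in> Xr i} \<and>
     R \<in> carrier_mat m n \<and> (\<forall>i<m. row R i \<in> XS - Xr i)"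

definition is_generator_matrix :: "nat \<Rightarrow> 'a::field vec set \<Rightarrow> 'a mat \<Rightarrow> bool" where
  "is_generator_matrix n W G \<longleftrightarrow>
     G \<in> carrier_mat (subspace_dim n W) n \<and> vec_space.row_space n G = W"

text \<open>Below, \<open>VS\<close> and \<open>V i\<close> are generator matrices of the sender's and the receivers' spaces, so
  that \<open>d_S\<close> and \<open>d_i\<close> are \<open>dim_row VS\<close> and \<open>dim_row (V i)\<close>; and \<open>R_i X\<close> is row \<open>i\<close> of \<open>R * X\<close>.\<close>

definition is_message_space ::
  "nat \<Rightarrow> nat \<Rightarrow> nat \<Rightarrow> 'a::field mat \<Rightarrow> 'a mat set \<Rightarrow> bool" where
  "is_message_space t n \<delta> VS Msg \<longleftrightarrow>
     Msg \<subseteq> carrier_mat n t \<and>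
     (\<exists>d \<ge> 2 * \<delta> + 1. has_min_rank_dist Msg d) \<and>
     has_min_rank_dist {VS * X | X. X \<in> Msg} (2 * \<delta> + 1)"

definition represents_ecic ::
  "nat \<Rightarrow> nat \<Rightarrow> 'a::field mat \<Rightarrow> 'a mat \<Rightarrow> (nat \<Rightarrow> 'a mat) \<Rightarrow> 'a mat set \<Rightarrow> nat \<Rightarrow>
   nat \<Rightarrow> 'a mat \<Rightarrow> bool" where
  "represents_ecic t m R VS V Msg \<delta> N L \<longleftrightarrow>
     N > 0 \<and> L \<in> carrier_mat N (dim_row VS) \<and>
     (\<forall>i<m. \<exists>D \<in> carrier_mat N t \<times> carrier_mat (dim_row (V i)) t \<rightarrow> carrier_vec t.
        \<forall>X\<in>Msg. \<forall>W\<in>carrier_mat N t. mat_rank W \<le> \<delta> \<longrightarrow>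
          D (L * VS * X + W, V i * X) = row (R * X) i)"

definition opt_ecic_length ::
  "nat \<Rightarrow> nat \<Rightarrow> 'a::field mat \<Rightarrow> 'a mat \<Rightarrow> (nat \<Rightarrow> 'a mat) \<Rightarrow> 'a mat set \<Rightarrow> nat \<Rightarrow> nat" where
  "opt_ecic_length t m R VS V Msg \<delta> = (LEAST N. \<exists>L. represents_ecic t m R VS V Msg \<delta> N L)"

definition Z_set ::
  "nat \<Rightarrow> nat \<Rightarrow> 'a::field mat \<Rightarrow> (nat \<Rightarrow> 'a mat) \<Rightarrow> nat \<Rightarrow> nat \<Rightarrow> 'a mat set" where
  "Z_set t n R V \<delta> i =
     {Z \<in> carrier_mat n t. V i * Z = 0\<^sub>m (dim_row (V i)) t \<and> row (R * Z) i \<noteq> 0\<^sub>v t \<and>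
        mat_rank Z \<ge> 2 * \<delta> + 1}"

text \<open>The members of \<open>J\<close> are sets of messages, i.e. subsets of \<open>Msg\<close>. If arbitrary subsets of
  \<open>carrier_mat n t\<close> were admitted, codes would be unconstrained on them and the bound would fail:
  take \<open>m = n = t = 2\<close>, \<open>\<delta> = 0\<close>, \<open>R = VS = 1\<^sub>m 2\<close>, zero receiver spaces, and \<open>Msg\<close> consisting of
  the zero matrix and one matrix unit; then length 1 suffices, while the set of all 2 by 2 matrices
  would have pairwise differences in the union of the \<open>Z_set\<close>s and needs length 2.\<close>

definition J_family ::
  "nat \<Rightarrow> nat \<Rightarrow> nat \<Rightarrow> 'a::field mat \<Rightarrow> (nat \<Rightarrow> 'a mat) \<Rightarrow> 'a mat set \<Rightarrow> nat \<Rightarrow> 'a mat set set"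
  where
  "J_family t m n R V Msg \<delta> =
     {U. U \<subseteq> Msg \<and>
         (\<forall>X\<in>U. \<forall>X'\<in>U. X \<noteq> X' \<longrightarrow> X - X' \<in> (\<Union>i<m. Z_set t n R V \<delta> i))}"

definition alpha ::
  "nat \<Rightarrow> nat \<Rightarrow> nat \<Rightarrow> 'a::{finite,field} mat \<Rightarrow> (nat \<Rightarrow> 'a mat) \<Rightarrow> 'a mat set \<Rightarrow> nat \<Rightarrow> real" where
  "alpha t m n R V Msg \<delta> =
     Max {log (real CARD('a)) (real (card U)) | U. U \<in> J_family t m n R V Msg \<delta> \<and> U \<noteq> {}}"

end

theory Submission
  imports Defs
begin

text \<open>Let \<open>L\<close> represent an ECIC of length \<open>N\<close> and let \<open>U\<close> attain \<open>\<alpha>\<close>. Two distinct members of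
  \<open>U\<close> are confusable at some receiver, and a matrix of rank at most \<open>2\<delta>\<close> is a difference of two
  errors of rank at most \<open>\<delta>\<close>; hence \<open>X \<mapsto> L V\<^sup>S X\<close> maps \<open>U\<close> injectively onto a code with distances
  at least \<open>2\<delta> + 1\<close>. Erasing rows lowers each rank by at most one per row, so erasing suitably
  many of them makes the minimum distance equal to \<open>2\<delta> + 1\<close>. An ECIC exists at all because the
  identity matrix represents one.\<close>

section \<open>Rank factorization\<close>

text \<open>Passes between two forms of confusability: the difference of two codewords is a
  difference of two errors, or the two received words coincide. Both directions are used
  below.\<close>

lemma mat_diff_eq_diff_iff:
  fixes A B C D :: "'a::ring mat"
  assumes A: "A \<in> carrier_mat nr nc" and B: "B \<in> carrier_mat nr nc"
    and C: "C \<in> carrier_mat nr nc" and D: "D \<in> carrier_mat nr nc"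
  shows "A - B = C - D \<longleftrightarrow> A + D = B + C"
proof -
  have *: "a - b = c - d \<longleftrightarrow> a + d = b + c" for a b c d :: 'a
    by (metis add.commute add_diff_cancel_right' diff_add_eq eq_diff_eq)
  show ?thesis
    using assms by (auto simp: mat_eq_iff *)
qed

lemma mat_diff_eq_zeroD:
  fixes A B :: "'a::ring mat"
  assumes "A \<in> carrier_mat nr nc" "B \<in> carrier_mat nr nc" "A - B = 0\<^sub>m nr nc"
  shows "A = B"
  using mat_diff_eq_diff_iff[OF assms(1,2) zero_carrier_mat zero_carrier_mat] assms
  by (simp add: minus_r_inv_mat[OF zero_carrier_mat])

lemma mat_rank_carrier: "A \<in> carrier_mat nr nc \<Longrightarrow> mat_rank A = vec_space.rank nr A"
  by (auto simp: mat_rank_def)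

lemma mat_rank_zero [simp]: "mat_rank (0\<^sub>m nr nc) = 0"
  by (simp add: mat_rank_def vec_space.rank_0I)

lemma mat_rank_add_le:
  assumes "A \<in> carrier_mat nr nc" "B \<in> carrier_mat nr nc"
  shows "mat_rank (A + B) \<le> mat_rank A + mat_rank B"
  using vec_space.rank_subadditive[OF assms] assms by (simp add: mat_rank_def)

text \<open>Each index \<open>l\<close> contributes an outer product, of rank at most 1, and rank is
  subadditive. The product is spelled out in entries so that splitting it or changing a sign is mere
  manipulation of a sum.\<close>

lemma mat_rank_le_sum_products:
  fixes f :: "nat \<Rightarrow> nat \<Rightarrow> 'a::field"
  shows "mat_rank (mat nr nc (\<lambda>(i, j). \<Sum>l<k. f i l * g l j)) \<le> k"
proof (induction k)
  case 0
  have "mat nr nc (\<lambda>(i, j). \<Sum>l<0. f i l * g l j) = 0\<^sub>m nr nc"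
    by (intro eq_matI) auto
  then show ?case by (metis mat_rank_zero le_refl)
next
  case (Suc k)
  let ?S = "\<lambda>k. mat nr nc (\<lambda>(i, j). \<Sum>l<k. f i l * g l j)"
  let ?P = "mat nr nc (\<lambda>(i, j). f i k * g k j)"
  have "?S (Suc k) = ?S k + ?P"
    by (intro eq_matI) auto
  moreover have "mat_rank ?P \<le> 1"
    unfolding mat_rank_def
    by (rule vec_space.rank_le_1_product_entries[where nc = nc and f = "\<lambda>i. f i k" and g = "\<lambda>j. g k j"]) auto
  moreover have "mat_rank (?S k + ?P) \<le> mat_rank (?S k) + mat_rank ?P"
    by (intro mat_rank_add_le) auto
  ultimately show ?case using Suc by simp
qed

text \<open>A maximal independent set of columns has as many elements as the rank and spans all
  columns. \<open>f\<close> lists these columns and \<open>g\<close> the coefficients; this is the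
  converse of \<open>mat_rank_le_sum_products\<close>.\<close>

lemma rank_factorization:
  fixes A :: "'a::field mat"
  assumes A: "A \<in> carrier_mat nr nc" and k: "mat_rank A \<le> k"
  obtains f g where "A = mat nr nc (\<lambda>(i, j). \<Sum>l<k. f i l * g l j)"
proof -
  interpret vec_space "TYPE('a)" nr .
  have sub: "set (cols A) \<subseteq> carrier_vec nr" using A cols_dim by blast
  obtain S where max: "maximal S (\<lambda>T. T \<subseteq> set (cols A) \<and> lin_indpt T)"
    using maximal_exists_superset[of "set (cols A)" "\<lambda>T. T \<subseteq> set (cols A) \<and> lin_indpt T" "{}"]
    by (auto simp: finite_lin_indpt2)
  have S: "S \<subseteq> set (cols A)" "lin_indpt S" using max by (auto simp: maximal_def)
  have finS: "finite S" using S(1) finite_subset by blast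
  have Sc: "S \<subseteq> carrier_vec nr" using S(1) sub by blast
  have card: "card S \<le> k" using rank_card_indpt[OF A max] k A by (simp add: mat_rank_carrier)
  \<comment> \<open>A column outside the span could be adjoined to \<open>S\<close>, against
    maximality.\<close>
  have span: "x \<in> span S" if x: "x \<in> set (cols A)" for x
  proof (rule ccontr)
    assume n: "x \<notin> span S"
    have xS: "x \<notin> S" using n Sc in_own_span[of S] by auto
    have "lin_indpt (S \<union> {x})" 
      using lin_dep_iff_in_span[of S x] S Sc x sub xS n by auto
    then have "S \<union> {x} = S" using max S(1) x unfolding maximal_def by blast
    then show False using xS by blast
  qed
  have "\<exists>a. \<forall>j<nc. col A j = lincomb (a j) S"
  proof -
    have "\<exists>b. col A j = lincomb b S" if "j < nc" for j
      using span[of "col A j"] finite_span[OF finS] Sc that A 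
      by (auto simp: cols_def)
    then show ?thesis by metis
  qed
  then obtain a where a: "\<And>j. j < nc \<Longrightarrow> col A j = lincomb (a j) S" by blast
  obtain h where h: "bij_betw h {..<card S} S"
    using ex_bij_betw_nat_finite[OF finS] by (auto simp: atLeast0LessThan)
  \<comment> \<open>The value 0 beyond \<open>card S\<close> pads the sum to exactly
    \<open>k\<close> terms; whatever \<open>g\<close> is there gets multiplied by 0.\<close>
  define f where "f i l = (if l < card S then h l $ i else 0)" for i l
  define g where "g l j = a j (h l)" for l j
  have "A = mat nr nc (\<lambda>(i, j). \<Sum>l<k. f i l * g l j)"
  proof (rule eq_matI)
    fix i j assume "i < dim_row (mat nr nc (\<lambda>(i, j). \<Sum>l<k. f i l * g l j))"
      "j < dim_col (mat nr nc (\<lambda>(i, j). \<Sum>l<k. f i l * g l j))"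
    then have ij: "i < nr" "j < nc" by auto
    have "A $$ (i, j) = col A j $ i" using ij A by simp
    also have "\<dots> = (\<Sum>x\<in>S. a j x * x $ i)"
      using a[OF ij(2)] lincomb_index[OF ij(1) Sc] by simp
    also have "\<dots> = (\<Sum>l<card S. a j (h l) * h l $ i)"
      using sum.reindex_bij_betw[OF h, of "\<lambda>x. a j x * x $ i"] by simp
    also have "\<dots> = (\<Sum>l<card S. f i l * g l j)"
      by (intro sum.cong) (auto simp: f_def g_def)
    also have "\<dots> = (\<Sum>l<k. f i l * g l j)"
      using card by (intro sum.mono_neutral_left) (auto simp: f_def)
    finally show "A $$ (i, j) = mat nr nc (\<lambda>(i, j). \<Sum>l<k. f i l * g l j) $$ (i, j)"
      using ij by simp
  qed (use A in auto)
  then show ?thesis by (rule that)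
qed

lemma mat_rank_uminus_le:
  fixes A :: "'a::field mat"
  assumes A: "A \<in> carrier_mat nr nc" and k: "mat_rank A \<le> k"
  shows "mat_rank (- A) \<le> k"
proof -
  obtain f g where fg: "A = mat nr nc (\<lambda>(i, j). \<Sum>l<k. f i l * g l j)"
    using rank_factorization[OF A k] .
  have eq: "- A = mat nr nc (\<lambda>(i, j). \<Sum>l<k. (- f i l) * g l j)"
    unfolding fg by (intro eq_matI) (auto simp: sum_negf)
  show ?thesis unfolding eq by (rule mat_rank_le_sum_products)
qed

lemma mat_rank_diff_le:
  fixes A :: "'a::field mat"
  assumes A: "A \<in> carrier_mat nr nc" and B: "B \<in> carrier_mat nr nc"
  shows "mat_rank (A - B) \<le> mat_rank A + mat_rank B"
  unfolding minus_add_uminus_mat[OF A B]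
  using mat_rank_add_le[OF A uminus_carrier_mat[OF B]] mat_rank_uminus_le[OF B order_refl]
  by linarith

text \<open>Cut a factorization with \<open>a + b\<close> terms after the first \<open>a\<close>
  terms. The remaining \<open>b\<close> terms enter \<open>W2\<close> with the opposite sign, which
  turns the sum into a difference of two errors.\<close>

lemma mat_rank_le_add_split:
  fixes W :: "'a::field mat"
  assumes W: "W \<in> carrier_mat nr nc" and "mat_rank W \<le> a + b"
  obtains W1 W2 where "W1 \<in> carrier_mat nr nc" "W2 \<in> carrier_mat nr nc"
    "mat_rank W1 \<le> a" "mat_rank W2 \<le> b" "W = W1 - W2"
proof -
  obtain f g where fg: "W = mat nr nc (\<lambda>(i, j). \<Sum>l<a + b. f i l * g l j)"
    using rank_factorization[OF assms] .
  define W1 where "W1 = mat nr nc (\<lambda>(i, j). \<Sum>l<a. f i l * g l j)"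
  define W2 where "W2 = mat nr nc (\<lambda>(i, j). \<Sum>l<b. (- f i (a + l)) * g (a + l) j)"
  have split: "(\<Sum>l<a + b. F l) = (\<Sum>l<a. F l) + (\<Sum>l<b. F (a + l))" for F :: "nat \<Rightarrow> 'a"
    by (induction b) (auto simp: add.assoc)
  have "W = W1 - W2"
    unfolding fg W1_def W2_def by (intro eq_matI) (auto simp: split sum_negf)
  moreover have "mat_rank W1 \<le> a" "mat_rank W2 \<le> b"
    unfolding W1_def W2_def
    using mat_rank_le_sum_products[of nr nc f g a]
      mat_rank_le_sum_products[of nr nc "\<lambda>i l. - f i (a + l)" "\<lambda>l. g (a + l)" b] by auto
  ultimately show ?thesis using that[of W1 W2] by (auto simp: W1_def W2_def)
qed

section \<open>Puncturing\<close>

text \<open>Erased rows are overwritten by zeros and not removed, so a punctured code stays in the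
  same \<open>carrier_mat\<close> and differences need no change of dimension.\<close>

definition keep_rows :: "nat \<Rightarrow> 'a::zero mat \<Rightarrow> 'a mat" where
  "keep_rows k A = mat (dim_row A) (dim_col A) (\<lambda>(i, j). if i < k then A $$ (i, j) else 0)"

lemma keep_rows_carrier [simp]: "A \<in> carrier_mat nr nc \<Longrightarrow> keep_rows k A \<in> carrier_mat nr nc"
  by (simp add: keep_rows_def)

lemma keep_rows_diff:
  fixes A :: "'a::field mat"
  assumes "A \<in> carrier_mat nr nc" "B \<in> carrier_mat nr nc"
  shows "keep_rows k A - keep_rows k B = keep_rows k (A - B)"
  using assms by (intro eq_matI) (auto simp: keep_rows_def)

lemma keep_rows_all: "A \<in> carrier_mat nr nc \<Longrightarrow> keep_rows nr A = A"
  by (intro eq_matI) (auto simp: keep_rows_def)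

lemma mat_rank_keep_rows_0: "mat_rank (keep_rows 0 A) = 0"
proof -
  have "keep_rows 0 A = 0\<^sub>m (dim_row A) (dim_col A)"
    by (intro eq_matI) (auto simp: keep_rows_def)
  then show ?thesis by simp
qed

text \<open>The two matrices differ only in row \<open>k\<close>, and a matrix supported on one row
  has rank at most 1.\<close>

lemma mat_rank_keep_rows_Suc_le:
  fixes A :: "'a::field mat"
  shows "mat_rank (keep_rows (Suc k) A) \<le> mat_rank (keep_rows k A) + 1"
proof -
  \<comment> \<open>The sum with a single term gives \<open>?E\<close> the shape required by
    \<open>mat_rank_le_sum_products\<close>.\<close>
  let ?E = "mat (dim_row A) (dim_col A)
    (\<lambda>(i, j). \<Sum>l<(1::nat). (if i = k then 1 else 0) * A $$ (k, j))"
  have eq: "keep_rows (Suc k) A = keep_rows k A + ?E"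
    by (intro eq_matI) (auto simp: keep_rows_def less_Suc_eq)
  have "mat_rank (keep_rows (Suc k) A) \<le> mat_rank (keep_rows k A) + mat_rank ?E"
    unfolding eq by (rule mat_rank_add_le[of _ "dim_row A" "dim_col A"]) (auto simp: keep_rows_def)
  also have "mat_rank ?E \<le> 1"
    by (rule mat_rank_le_sum_products)
  finally show ?thesis by simp
qed

text \<open>\<open>opt_code_length\<close> asks for minimum distance exactly \<open>d\<close>, while
  the code at hand only has distances at least \<open>d\<close>. Take the least \<open>k\<close> for
  which keeping the first \<open>k\<close> rows leaves all distances at least \<open>d\<close>. With
  one row less some pair drops below \<open>d\<close>, and a row changes a rank by at most 1, so
  this pair is at distance exactly \<open>d\<close>.\<close>

lemma opt_code_length_le:
  fixes C :: "'a::{finite,field} mat set"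
  assumes C: "C \<subseteq> carrier_mat s t"
    and dist: "\<And>A B. A \<in> C \<Longrightarrow> B \<in> C \<Longrightarrow> A \<noteq> B \<Longrightarrow> d \<le> mat_rank (A - B)"
    and d: "d > 0" and two: "A0 \<in> C" "B0 \<in> C" "A0 \<noteq> B0"
  shows "opt_code_length TYPE('a) t (log (real CARD('a)) (real (card C))) d \<le> s"
proof -
  define far where
    "far k \<longleftrightarrow> (\<forall>A\<in>C. \<forall>B\<in>C. A \<noteq> B \<longrightarrow> d \<le> mat_rank (keep_rows k (A - B)))" for k
  have dc: "A - B \<in> carrier_mat s t" if "A \<in> C" "B \<in> C" for A B
    using that C minus_carrier_mat by blast
  have "far s"
    unfolding far_def using dist keep_rows_all[OF dc] by simp
  \<comment> \<open>The two distinct words enter here: with all rows erased their distance is 0, so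
    the least \<open>k\<close> is a successor.\<close>
  have "\<not> far 0"
    using two d by (auto simp: far_def mat_rank_keep_rows_0)
  define k where "k = (LEAST k. far k)"
  have k: "far k" unfolding k_def using \<open>far s\<close> by (rule LeastI)
  obtain k' where k': "k = Suc k'" using k \<open>\<not> far 0\<close> by (cases k) auto
  have "\<not> far k'" using k' not_less_Least[of k' far] by (simp add: k_def)
  then obtain A B where AB: "A \<in> C" "B \<in> C" "A \<noteq> B" "mat_rank (keep_rows k' (A - B)) < d"
    by (auto simp: far_def not_le)
  have eq: "mat_rank (keep_rows k (A - B)) = d"
  proof (rule antisym)
    show "mat_rank (keep_rows k (A - B)) \<le> d"
      using mat_rank_keep_rows_Suc_le[of k' "A - B"] AB(4) k' by simp
    show "d \<le> mat_rank (keep_rows k (A - B))"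
      using k AB by (auto simp: far_def)
  qed
  have kd: "keep_rows k A - keep_rows k B = keep_rows k (A - B)" if "A \<in> C" "B \<in> C" for A B
    using that C by (intro keep_rows_diff[of _ s t]) auto
  \<comment> \<open>Positive distances keep the words distinct, so puncturing preserves the size of
    the code.\<close>
  have inj: "inj_on (keep_rows k) C"
  proof (rule inj_onI, rule ccontr)
    fix X Y assume XY: "X \<in> C" "Y \<in> C" "keep_rows k X = keep_rows k Y" "X \<noteq> Y"
    have zero: "keep_rows k (X - Y) = 0\<^sub>m s t"
      using kd[OF XY(1,2)] XY(2,3) C minus_r_inv_mat[of "keep_rows k Y" s t] by auto
    have "d \<le> mat_rank (keep_rows k (X - Y))"
      using k XY(1,2,4) unfolding far_def by blast
    then show False using d by (simp add: zero)
  qed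
  have "keep_rows k A \<noteq> keep_rows k B" using inj AB by (auto dest: inj_onD)
  then have "\<exists>P\<in>keep_rows k ` C. \<exists>Q\<in>keep_rows k ` C. P \<noteq> Q \<and> mat_rank (P - Q) = d"
    using AB(1,2) kd[OF AB(1,2)] eq by (metis imageI)
  moreover have "d \<le> mat_rank (P - Q)"
    if PQ: "P \<in> keep_rows k ` C" "Q \<in> keep_rows k ` C" "P \<noteq> Q" for P Q
  proof -
    obtain X Y where "X \<in> C" "Y \<in> C" "P = keep_rows k X" "Q = keep_rows k Y"
      using PQ(1,2) by blast
    then show ?thesis using kd[of X Y] k PQ(3) unfolding far_def by metis
  qed
  ultimately have "has_min_rank_dist (keep_rows k ` C) d"
    unfolding has_min_rank_dist_def by blast
  moreover have "keep_rows k ` C \<subseteq> carrier_mat s t" using C by auto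
  moreover have "card (keep_rows k ` C) = card C" using inj by (rule card_image)
  ultimately show ?thesis
    unfolding opt_code_length_def by (intro Least_le exI[of _ "keep_rows k ` C"]) simp
qed

section \<open>Error-correcting index codes\<close>

lemma finite_carrier_mat: "finite (carrier_mat nr nc :: 'a::finite mat set)"
proof (rule finite_subset)
  show "(carrier_mat nr nc :: 'a mat set) \<subseteq> mat nr nc ` (({..<nr} \<times> {..<nc}) \<rightarrow>\<^sub>E UNIV)"
  proof
    fix A :: "'a mat" assume A: "A \<in> carrier_mat nr nc"
    have "A = mat nr nc (restrict (\<lambda>p. A $$ p) ({..<nr} \<times> {..<nc}))"
      using A by (intro eq_matI) auto
    then show "A \<in> mat nr nc ` (({..<nr} \<times> {..<nc}) \<rightarrow>\<^sub>E UNIV)"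
      by (rule image_eqI[where f = "mat nr nc"]) auto
  qed
qed (intro finite_imageI finite_PiE; simp)

text \<open>\<open>Max\<close> is attained because the set of logarithms is finite,
  \<open>Msg\<close> having finitely many subsets, and nonempty, every singleton lying in
  \<open>J_family\<close> vacuously.\<close>

lemma alpha_attained:
  assumes "finite Msg" "Msg \<noteq> {}"
  obtains U where "U \<in> J_family t m n R V Msg \<delta>" "U \<noteq> {}"
    "alpha t m n R V Msg \<delta> = log (real CARD('a)) (real (card (U :: 'a::{finite,field} mat set)))"
proof -
  let ?S = "{log (real CARD('a)) (real (card U)) | U. U \<in> J_family t m n R V Msg \<delta> \<and> U \<noteq> {}}"
  have "?S \<subseteq> (\<lambda>U. log (real CARD('a)) (real (card U))) ` Pow Msg"
    by (auto simp: J_family_def)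
  then have "finite ?S" using assms(1) by (meson finite_Pow_iff finite_imageI finite_subset)
  moreover obtain X where "X \<in> Msg" using assms(2) by blast
  then have "{X} \<in> J_family t m n R V Msg \<delta>" by (auto simp: J_family_def)
  then have "?S \<noteq> {}" by blast
  ultimately have "alpha t m n R V Msg \<delta> \<in> ?S"
    unfolding alpha_def by (rule Max_in)
  then show ?thesis using that by blast
qed

text \<open>Row \<open>i\<close> of \<open>R\<close> is a combination of the rows of
  \<open>G\<close>, with coefficients \<open>y\<close>. Hence row \<open>i\<close> of
  \<open>R * X\<close> is the same combination of the rows of \<open>G * X\<close>, and depends on
  \<open>X\<close> only through that product.\<close>

lemma row_mult_eq_of_row_space:
  fixes G :: "'a::field mat"
  assumes G: "G \<in> carrier_mat k n" and R: "R \<in> carrier_mat m n" and i: "i < m"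
    and r: "row R i \<in> vec_space.row_space n G"
    and X: "X \<in> carrier_mat n t" "X' \<in> carrier_mat n t" and eq: "G * X = G * X'"
  shows "row (R * X) i = row (R * X') i"
proof -
  obtain y where y: "y \<in> carrier_vec k" "row R i = G\<^sup>T *\<^sub>v y"
    using r vec_space.row_space_eq[OF G] G by auto
  have entry: "(R * Y) $$ (i, j) = y \<bullet> col (G * Y) j"
    if Y: "Y \<in> carrier_mat n t" and j: "j < t" for Y j
  proof -
    have "(R * Y) $$ (i, j) = (G\<^sup>T *\<^sub>v y) \<bullet> col Y j"
      using R Y i j y(2) by simp
    also have "\<dots> = y \<bullet> (G *\<^sub>v col Y j)"
      using transpose_vec_mult_scalar[OF G, of "col Y j" y] G Y y(1) j
      by simp
    also have "\<dots> = y \<bullet> col (G * Y) j"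
      by (simp only: col_mult2[OF G Y j])
    finally show ?thesis .
  qed
  show ?thesis
    using entry[OF X(1)] entry[OF X(2)] eq R X i by (intro eq_vecI) auto
qed

text \<open>The decoder picks any message that explains the observation; by the first assumption the
  choice does not affect the decoded value.\<close>

lemma decoder_exists:
  assumes "\<And>X W X' W'. X \<in> M \<Longrightarrow> X' \<in> M \<Longrightarrow> W \<in> E \<Longrightarrow> W' \<in> E \<Longrightarrow> p X W = p X' W' \<Longrightarrow> v X = v X'"
    and "\<And>X. X \<in> M \<Longrightarrow> v X \<in> T" and "z \<in> T"
  shows "\<exists>D \<in> S \<rightarrow> T. \<forall>X\<in>M. \<forall>W\<in>E. D (p X W) = v X"
proof -
  \<comment> \<open>The default \<open>z\<close> serves the inputs that no message and error
    produce, so that \<open>D\<close> takes all its values in \<open>T\<close>.\<close>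
  define D where "D y = (if \<exists>X\<in>M. \<exists>W\<in>E. y = p X W
     then v (SOME X. X \<in> M \<and> (\<exists>W\<in>E. y = p X W)) else z)" for y
  have some: "(SOME X. X \<in> M \<and> (\<exists>W\<in>E. y = p X W)) \<in> M \<and>
      (\<exists>W\<in>E. y = p (SOME X. X \<in> M \<and> (\<exists>W\<in>E. y = p X W)) W)"
    if "\<exists>X\<in>M. \<exists>W\<in>E. y = p X W" for y
    by (rule someI_ex) (use that in blast)
  have "D \<in> S \<rightarrow> T"
    using some assms(2,3) by (auto simp: D_def)
  moreover have "D (p X W) = v X" if "X \<in> M" "W \<in> E" for X W
  proof -
    have ex: "\<exists>X'\<in>M. \<exists>W'\<in>E. p X W = p X' W'" using that by blast
    from some[OF ex] show ?thesis
      unfolding D_def using ex that assms(1) by (smt (verit))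
  qed
  ultimately show ?thesis by blast
qed

text \<open>Ensures that the \<open>LEAST\<close> in \<open>opt_ecic_length\<close> ranges over a
  nonempty set. If two received words agree, the words \<open>VS * X\<close> and
  \<open>VS * X'\<close> differ by a difference of two errors, of rank at most
  \<open>2 * \<delta>\<close>; this is below the minimum distance, so they are equal and determine
  the requested row.\<close>

lemma one_mat_represents_ecic:
  fixes R VS :: "'a::{finite,field} mat"
  assumes "iccsi_instance t m n XX XS Xr R"
    and VS: "is_generator_matrix n XS VS"
    and Msg: "is_message_space t n \<delta> VS Msg"
  shows "represents_ecic t m R VS V Msg \<delta> (dim_row VS) (1\<^sub>m (dim_row VS))"
proof -
  let ?N = "dim_row VS"
  have R: "R \<in> carrier_mat m n" "\<And>i. i < m \<Longrightarrow> row R i \<in> XS"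
    using assms(1) by (auto simp: iccsi_instance_def)
  have VSc: "VS \<in> carrier_mat ?N n" and VSr: "vec_space.row_space n VS = XS"
    using VS by (auto simp: is_generator_matrix_def)
  have M: "Msg \<subseteq> carrier_mat n t"
    and far: "\<And>X X'. X \<in> Msg \<Longrightarrow> X' \<in> Msg \<Longrightarrow> VS * X \<noteq> VS * X' \<Longrightarrow>
      2 * \<delta> + 1 \<le> mat_rank (VS * X - VS * X')"
    using Msg by (auto simp: is_message_space_def has_min_rank_dist_def)
  \<comment> \<open>Code lengths must be positive. A \<open>VS\<close> without rows would send all
    messages to one word, whereas a minimum distance presupposes two distinct words.\<close>
  have pos: "?N > 0"
  proof (rule ccontr)
    assume "\<not> ?N > 0"
    then have "VS * X = VS * X'" if "X \<in> Msg" "X' \<in> Msg" for X X'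
      using that M by (intro eq_matI) auto
    then show False
      using Msg unfolding is_message_space_def has_min_rank_dist_def by blast
  qed
  have VSX: "VS * X \<in> carrier_mat ?N t" if "X \<in> Msg" for X
    by (rule mult_carrier_mat[OF VSc]) (use that M in blast)
  have "\<exists>D \<in> carrier_mat ?N t \<times> carrier_mat (dim_row (V i)) t \<rightarrow> carrier_vec t.
      \<forall>X\<in>Msg. \<forall>W\<in>{W \<in> carrier_mat ?N t. mat_rank W \<le> \<delta>}.
        D (1\<^sub>m ?N * VS * X + W, V i * X) = row (R * X) i" if i: "i < m" for i
  proof (rule decoder_exists[where v = "\<lambda>X. row (R * X) i" and z = "0\<^sub>v t"
        and p = "\<lambda>X W. (1\<^sub>m ?N * VS * X + W, V i * X)"])
    fix X W X' W'
    assume X: "X \<in> Msg" "X' \<in> Msg"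
      and W: "W \<in> {W \<in> carrier_mat ?N t. mat_rank W \<le> \<delta>}"
        "W' \<in> {W \<in> carrier_mat ?N t. mat_rank W \<le> \<delta>}"
      and eq: "(1\<^sub>m ?N * VS * X + W, V i * X) = (1\<^sub>m ?N * VS * X' + W', V i * X')"
    have sum: "VS * X + W = VS * X' + W'" using eq unfolding left_mult_one_mat[OF VSc] by (rule Pair_inject)
    have "VS * X - VS * X' = W' - W"
      using mat_diff_eq_diff_iff[OF VSX[OF X(1)] VSX[OF X(2)], of W' W] W sum by simp
    then have "mat_rank (VS * X - VS * X') \<le> 2 * \<delta>"
      using mat_rank_diff_le[of W' ?N t W] W by simp
    then have "VS * X = VS * X'" using far[OF X] by force
    then show "row (R * X) i = row (R * X') i"
      using X M R i VSr by (intro row_mult_eq_of_row_space[OF VSc R(1) i]) auto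
  next
    fix X assume "X \<in> Msg"
    then show "row (R * X) i \<in> carrier_vec t"
      using M R(1) i by (intro carrier_vecI) auto
  qed (rule zero_carrier_vec)
  then show ?thesis
    unfolding represents_ecic_def using pos by (simp add: Ball_def imp_conjL)
qed

text \<open>If the codewords were closer, two admissible errors would make the received words equal.
  A receiver \<open>i\<close> with \<open>X - X'\<close> in its \<open>Z_set\<close> has the same
  side information for both messages, so it would decode them alike, although the requested rows
  differ.\<close>

lemma ecic_separates:
  fixes L VS R :: "'a::{finite,field} mat"
  assumes L: "represents_ecic t m R VS V Msg \<delta> N L"
    and VS: "VS \<in> carrier_mat (dim_row VS) n" and M: "Msg \<subseteq> carrier_mat n t"
    and R: "R \<in> carrier_mat m n" and V: "\<And>i. i < m \<Longrightarrow> V i \<in> carrier_mat (dim_row (V i)) n"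
    and X: "X \<in> Msg" "X' \<in> Msg"
    and Z: "X - X' \<in> (\<Union>i<m. Z_set t n R V \<delta> i)"
  shows "2 * \<delta> + 1 \<le> mat_rank (L * VS * X - L * VS * X')"
proof (rule ccontr)
  assume "\<not> ?thesis"
  then have small: "mat_rank (L * VS * X - L * VS * X') \<le> \<delta> + \<delta>" by simp
  have Xc: "X \<in> carrier_mat n t" "X' \<in> carrier_mat n t" using X M by auto
  have LVS: "L * VS \<in> carrier_mat N n"
    by (rule mult_carrier_mat[OF _ VS]) (use L in \<open>simp add: represents_ecic_def\<close>)
  have c: "L * VS * X \<in> carrier_mat N t" "L * VS * X' \<in> carrier_mat N t"
    using mult_carrier_mat[OF LVS Xc(1)] mult_carrier_mat[OF LVS Xc(2)] .
  obtain i where i: "i < m" and Vi: "V i * (X - X') = 0\<^sub>m (dim_row (V i)) t"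
    and Ri: "row (R * (X - X')) i \<noteq> 0\<^sub>v t"
    using Z by (auto simp: Z_set_def)
  have "L * VS * X - L * VS * X' \<in> carrier_mat N t" using c by (intro minus_carrier_mat)
  then obtain W1 W2 where W: "W1 \<in> carrier_mat N t" "W2 \<in> carrier_mat N t"
    "mat_rank W1 \<le> \<delta>" "mat_rank W2 \<le> \<delta>" "L * VS * X - L * VS * X' = W1 - W2"
    using small by (rule mat_rank_le_add_split)
  have "V i * X = V i * X'"
    using mat_diff_eq_zeroD[OF mult_carrier_mat[OF V[OF i] Xc(1)] mult_carrier_mat[OF V[OF i] Xc(2)]]
      Vi mult_minus_distrib_mat[OF V[OF i] Xc] by simp
  \<comment> \<open>The errors are attached crosswise: \<open>W2\<close> to the word of
    \<open>X\<close> and \<open>W1\<close> to that of \<open>X'\<close>.\<close>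
  moreover have "L * VS * X + W2 = L * VS * X' + W1"
    using mat_diff_eq_diff_iff[OF c W(1,2)] W(5) by simp
  moreover obtain D where "\<And>X W. X \<in> Msg \<Longrightarrow> W \<in> carrier_mat N t \<Longrightarrow> mat_rank W \<le> \<delta> \<Longrightarrow>
      D (L * VS * X + W, V i * X) = row (R * X) i"
    using L i unfolding represents_ecic_def by blast
  ultimately have "row (R * X) i = row (R * X') i"
    using X W(1-4) by metis
  moreover have "row (R * (X - X')) i = row (R * X) i - row (R * X') i"
    unfolding mult_minus_distrib_mat[OF R Xc] using R Xc i by (intro eq_vecI) auto
  moreover have "row (R * X') i - row (R * X') i = 0\<^sub>v t"
    using R Xc i by (intro eq_vecI) auto
  ultimately show False using Ri by simp
qed

theorem mainTheorem11:
  fixes t m n \<delta> :: nat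
    and XX :: "'a::{finite,field} mat set" and XS :: "'a vec set" and Xr :: "nat \<Rightarrow> 'a vec set"
    and R VS :: "'a mat" and V :: "nat \<Rightarrow> 'a mat" and Msg :: "'a mat set"
  assumes "iccsi_instance t m n XX XS Xr R"
    and "is_generator_matrix n XS VS"
    and "\<And>i. i < m \<Longrightarrow> is_generator_matrix n (Xr i) (V i)"
    and "is_message_space t n \<delta> VS Msg"
    and "alpha t m n R V Msg \<delta> > 0"
  shows "opt_code_length TYPE('a) t (alpha t m n R V Msg \<delta>) (2 * \<delta> + 1)
           \<le> opt_ecic_length t m R VS V Msg \<delta>"
proof -
  define N where "N = opt_ecic_length t m R VS V Msg \<delta>"
  have "\<exists>N L. represents_ecic t m R VS V Msg \<delta> N L"
    using one_mat_represents_ecic[OF assms(1,2,4)] by blast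
  then have "\<exists>L. represents_ecic t m R VS V Msg \<delta> N L"
    unfolding N_def opt_ecic_length_def by (rule LeastI_ex)
  then obtain L where L: "represents_ecic t m R VS V Msg \<delta> N L" ..
  have M: "Msg \<subseteq> carrier_mat n t" "Msg \<noteq> {}"
    using assms(4) by (auto simp: is_message_space_def has_min_rank_dist_def)
  have VS: "VS \<in> carrier_mat (dim_row VS) n"
    using assms(2) by (auto simp: is_generator_matrix_def)
  have R: "R \<in> carrier_mat m n" using assms(1) by (simp add: iccsi_instance_def)
  have V: "V i \<in> carrier_mat (dim_row (V i)) n" if "i < m" for i
    using assms(3)[OF that] by (auto simp: is_generator_matrix_def)
  have finM: "finite Msg" using M(1) finite_carrier_mat finite_subset by blast
  obtain U where U: "U \<in> J_family t m n R V Msg \<delta>" "U \<noteq> {}"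
    and \<alpha>: "alpha t m n R V Msg \<delta> = log (real CARD('a)) (real (card U))"
    using alpha_attained[OF finM M(2)] .
  have UM: "U \<subseteq> Msg"
    and UZ: "\<And>X X'. X \<in> U \<Longrightarrow> X' \<in> U \<Longrightarrow> X \<noteq> X' \<Longrightarrow> X - X' \<in> (\<Union>i<m. Z_set t n R V \<delta> i)"
    using U(1) by (auto simp: J_family_def)
  let ?e = "\<lambda>X. L * VS * X"
  have LVS: "L * VS \<in> carrier_mat N n"
    by (rule mult_carrier_mat[OF _ VS]) (use L in \<open>simp add: represents_ecic_def\<close>)
  have ec: "?e X \<in> carrier_mat N t" if "X \<in> U" for X
    by (rule mult_carrier_mat[OF LVS]) (use that UM M(1) in blast)
  have far: "2 * \<delta> + 1 \<le> mat_rank (?e X - ?e X')" if "X \<in> U" "X' \<in> U" "X \<noteq> X'" for X X'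
    using that UM UZ by (intro ecic_separates[OF L VS M(1) R V]) auto
  have inj: "inj_on ?e U"
  proof (rule inj_onI, rule ccontr)
    fix X X' assume X: "X \<in> U" "X' \<in> U" "?e X = ?e X'" "X \<noteq> X'"
    then have "mat_rank (?e X - ?e X') = 0" using minus_r_inv_mat[OF ec[OF X(2)]] by simp
    then show False using far[OF X(1,2,4)] by simp
  qed
  \<comment> \<open>A single message would give logarithm 0, against positivity of
    \<open>alpha\<close>. So \<open>U\<close> has two distinct members, as an exact minimum distance
    requires.\<close>
  have "card U \<noteq> 1" using assms(5) \<alpha> by auto
  then obtain X X' where X: "X \<in> U" "X' \<in> U" "X \<noteq> X'"
    using U(2) by (metis is_singletonI' is_singleton_altdef)
  have "opt_code_length TYPE('a) t (log (real CARD('a)) (real (card (?e ` U)))) (2 * \<delta> + 1) \<le> N"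
  proof (rule opt_code_length_le)
    show "?e X \<noteq> ?e X'" using X inj by (auto dest: inj_onD)
  qed (use X ec far in auto)
  then show ?thesis using card_image[OF inj] \<alpha> by (simp add: N_def)
qed

end
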